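(* (Gain in work extraction for systems with memory.) Let $X^n=(X_1,\dots,X_n)$ and $Y^n=(Y_1,\dots,Y_n)$ be jointly distributed random vectors with finite alphabets, let $k_B T>0$, and for each $i$ let $o_i$ be a positive function of $x^i$. Suppose a controller with causal knowledge chooses, for each $i$ and each $(y^i,x^{i-1})$, a probability distribution $Q_{X_i|y^i,x^{i-1}}$ on the alphabet of $X_i$, and that the work extracted in cycle $i$ is $W_i=k_B T\ln\frac{Q_{X_i|Y^i,X^{i-1}}(X_i)}{o_i(X^i)}$. Then: (a) for every $i$ and every $(y^i,x^{i-1})$ of positive probability, the choice maximizing $E[W_i\,|\,Y^i=y^i,X^{i-1}=x^{i-1}]$ is $Q_{X_i|y^i,x^{i-1}}=P_{X_i|y^i,x^{i-1}}$; (b) the maximal expected total work is $$E[W_n(X^n||Y^n)]=-k_B T\sum_{i=1}^n\big[H(X_i|Y^i,X^{i-1})+O_i\big],\qquad O_i=E[\ln o_i(X^i)];$$ (c) if $E[W_n(X^n)]$ denotes the maximal expected total work when the controller has no access to the measurements (so that its choice at cycle $i$ depends on $x^{i-1}$ only, with the same functions $o_i$), then $$E[W_n(X^n||Y^n)]-E[W_n(X^n)]=k_B T\, I(Y^n\rightarrow X^n).$$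
   Context: $X_i$ is the state of the system in cycle $i$ and $Y_i$ the measurement in cycle $i$; $X^i=(X_1,\dots,X_i)$, $Y^i=(Y_1,\dots,Y_i)$, with $X^0$ empty. $P_{X_i|y^i,x^{i-1}}$ is the conditional distribution of $X_i$ given $Y^i=y^i$, $X^{i-1}=x^{i-1}$. $W_n(X^n||Y^n)$ denotes the total work $\sum_{i=1}^n W_i$ under the optimal choice with causal dependence on $X^{i-1}$ and $Y^i$. Entropies and mutual informations are in nats: $H(A|B)=-\sum_{a,b}P_{A,B}(a,b)\ln P_{A|B}(a|b)$. The directed information is $I(Y^n\rightarrow X^n)=\sum_{i=1}^n I(X_i;Y^i|X^{i-1})$. Work may be $-\infty$ when the chosen distribution gives mass $0$ to the realized state. *)

theory Defs
  imports "HOL-Probability.Probability"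
begin

text \<open>
  Processes are indexed from 1, as in \<open>X\<^sub>1, X\<^sub>2, \<dots>\<close>; index 0 is never used.  The vector
  \<open>X\<^sup>i = (X\<^sub>1, \<dots>, X\<^sub>i)\<close> is a list of length \<open>i\<close>, so \<open>X\<^sup>0\<close> is the empty list.
\<close>

definition hist :: "(nat \<Rightarrow> 'w \<Rightarrow> 'a) \<Rightarrow> nat \<Rightarrow> 'w \<Rightarrow> 'a list" where
  "hist Z i \<omega> = map (\<lambda>j. Z j \<omega>) [1..<Suc i]"

definition ln_ereal :: "real \<Rightarrow> ereal" where
  "ln_ereal x = (if x > 0 then ereal (ln x) else - \<infinity>)"

text \<open>
  The Bochner integral of the library is real-valued, but work can be \<open>- \<infinity>\<close>.  As usual, the
  expectation is the integral of the positive part minus that of the negative part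
  (\<^const>\<open>e2ennreal\<close> sends negative numbers to 0).  The value is meaningful unless both
  are infinite; here the positive part is bounded.
\<close>

definition ereal_expectation :: "'w measure \<Rightarrow> ('w \<Rightarrow> ereal) \<Rightarrow> ereal" where
  "ereal_expectation M f =
     enn2ereal (\<integral>\<^sup>+ \<omega>. e2ennreal (f \<omega>) \<partial>M) - enn2ereal (\<integral>\<^sup>+ \<omega>. e2ennreal (- f \<omega>) \<partial>M)"

lemma ereal_expectation_ereal:
  assumes "integrable M f"
  shows "ereal_expectation M (\<lambda>\<omega>. ereal (f \<omega>)) = ereal (integral\<^sup>L M f)"
proof -
  have fin: "(\<integral>\<^sup>+ \<omega>. ennreal (f \<omega>) \<partial>M) < \<infinity>" "(\<integral>\<^sup>+ \<omega>. ennreal (- f \<omega>) \<partial>M) < \<infinity>"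
    using assms by (auto simp: real_integrable_def less_top)
  have e: "enn2ereal x = ereal (enn2real x)" if "x < \<infinity>" for x
    using that by (cases x) (auto simp: enn2ereal_ennreal)
  show ?thesis
    using fin by (simp add: ereal_expectation_def real_lebesgue_integral_def[OF assms] e)
qed

text \<open>The event \<open>Y\<^sup>i = y\<^sup>i, X\<^sup>i\<^sup>-\<^sup>1 = x\<^sup>i\<^sup>-\<^sup>1\<close>.\<close>

definition context_event ::
    "'w measure \<Rightarrow> (nat \<Rightarrow> 'w \<Rightarrow> 'a) \<Rightarrow> (nat \<Rightarrow> 'w \<Rightarrow> 'b) \<Rightarrow> nat \<Rightarrow> 'b list \<Rightarrow> 'a list \<Rightarrow> 'w set" where
  "context_event M X Y i ys xs = {\<omega> \<in> space M. hist Y i \<omega> = ys \<and> hist X (i - 1) \<omega> = xs}"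

text \<open>
  The conditional distribution \<open>P\<^bsub>X\<^sub>i|y\<^sup>i,x\<^sup>i\<^sup>-\<^sup>1\<^esub>\<close>; it is only meaningful when
  the conditioning event has positive probability.
\<close>

definition cond_dist ::
    "'w measure \<Rightarrow> (nat \<Rightarrow> 'w \<Rightarrow> 'a) \<Rightarrow> (nat \<Rightarrow> 'w \<Rightarrow> 'b) \<Rightarrow> nat \<Rightarrow> 'b list \<Rightarrow> 'a list \<Rightarrow> 'a pmf" where
  "cond_dist M X Y i ys xs =
     embed_pmf (\<lambda>x. \<P>(\<omega> in M. X i \<omega> = x \<bar> hist Y i \<omega> = ys \<and> hist X (i - 1) \<omega> = xs))"

lemma pmf_cond_dist:
  assumes "prob_space M" and fin: "finite A" and X: "X i \<in> measurable M (count_space A)"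
    and E: "context_event M X Y i ys xs \<in> sets M"
    and pos: "measure M (context_event M X Y i ys xs) > 0"
  shows "pmf (cond_dist M X Y i ys xs) x =
    \<P>(\<omega> in M. X i \<omega> = x \<bar> hist Y i \<omega> = ys \<and> hist X (i - 1) \<omega> = xs)"
proof -
  interpret prob_space M by fact
  define E where "E = context_event M X Y i ys xs"
  define f where
    "f x = \<P>(\<omega> in M. X i \<omega> = x \<bar> hist Y i \<omega> = ys \<and> hist X (i - 1) \<omega> = xs)" for x
  have f: "f x = measure M {\<omega> \<in> E. X i \<omega> = x} / measure M E" for x
    unfolding f_def cond_prob_def E_def context_event_def
    by (intro arg_cong2[where f = "(/)"] arg_cong[where f = prob]) auto
  have XA: "X i \<omega> \<in> A" if "\<omega> \<in> E" for \<omega>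
    using measurable_space[OF X] that by (auto simp: E_def context_event_def)
  have 0: "f x = 0" if "x \<notin> A" for x
  proof -
    have "{\<omega> \<in> E. X i \<omega> = x} = {}" using XA that by auto
    then show ?thesis unfolding f by (simp only: measure_empty div_0)
  qed
  have s: "{\<omega> \<in> E. X i \<omega> = x} \<in> sets M" if "x \<in> A" for x
  proof -
    have "{\<omega> \<in> E. X i \<omega> = x} = E \<inter> (X i -` {x} \<inter> space M)"
      by (auto simp: E_def context_event_def)
    moreover have "X i -` {x} \<inter> space M \<in> sets M"
      using measurable_sets[OF X, of "{x}"] that by simp
    ultimately show ?thesis using E E_def by auto
  qed
  have "(\<Sum>x\<in>A. measure M {\<omega> \<in> E. X i \<omega> = x}) = measure M (\<Union>x\<in>A. {\<omega> \<in> E. X i \<omega> = x})"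
    by (rule finite_measure_finite_Union[symmetric])
       (use fin s in \<open>auto simp: disjoint_family_on_def\<close>)
  also have "(\<Union>x\<in>A. {\<omega> \<in> E. X i \<omega> = x}) = E" using XA by auto
  finally have sum1: "(\<Sum>x\<in>A. f x) = 1"
    using pos by (simp add: f sum_divide_distrib[symmetric] E_def)
  have nn: "0 \<le> f x" for x by (simp add: f)
  have "(\<integral>\<^sup>+x. ennreal (f x) \<partial>count_space UNIV) = (\<Sum>x\<in>A. ennreal (f x))"
    by (rule nn_integral_count_space'[OF fin]) (auto simp: 0)
  also have "\<dots> = 1" using sum1 nn by (simp add: sum_ennreal)
  finally have "pmf (embed_pmf f) x = f x" using nn by (intro pmf_embed_pmf)
  moreover have "cond_dist M X Y i ys xs = embed_pmf f"
    unfolding cond_dist_def f_def ..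
  ultimately show ?thesis by (simp add: f_def)
qed

definition causal_strategies ::
    "nat \<Rightarrow> (nat \<Rightarrow> 'a set) \<Rightarrow> (nat \<Rightarrow> 'b list \<Rightarrow> 'a list \<Rightarrow> 'a pmf) set" where
  "causal_strategies n A = {Q. \<forall>i\<in>{1..n}. \<forall>ys xs. set_pmf (Q i ys xs) \<subseteq> A i}"

definition blind_strategies ::
    "nat \<Rightarrow> (nat \<Rightarrow> 'a set) \<Rightarrow> (nat \<Rightarrow> 'b list \<Rightarrow> 'a list \<Rightarrow> 'a pmf) set" where
  "blind_strategies n A =
     {Q \<in> causal_strategies n A. \<forall>i\<in>{1..n}. \<forall>ys ys' xs. Q i ys xs = Q i ys' xs}"

text \<open>The parameter \<open>kT\<close> stands for the product \<open>k\<^sub>B T\<close>.\<close>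

definition work ::
    "real \<Rightarrow> (nat \<Rightarrow> 'a list \<Rightarrow> real) \<Rightarrow> (nat \<Rightarrow> 'w \<Rightarrow> 'a) \<Rightarrow> (nat \<Rightarrow> 'w \<Rightarrow> 'b) \<Rightarrow>
     (nat \<Rightarrow> 'b list \<Rightarrow> 'a list \<Rightarrow> 'a pmf) \<Rightarrow> nat \<Rightarrow> 'w \<Rightarrow> ereal" where
  "work kT oi X Y Q i \<omega> =
     ereal kT * ln_ereal (pmf (Q i (hist Y i \<omega>) (hist X (i - 1) \<omega>)) (X i \<omega>) / oi i (hist X i \<omega>))"

definition cond_expected_work ::
    "'w measure \<Rightarrow> real \<Rightarrow> (nat \<Rightarrow> 'a list \<Rightarrow> real) \<Rightarrow> (nat \<Rightarrow> 'w \<Rightarrow> 'a) \<Rightarrow> (nat \<Rightarrow> 'w \<Rightarrow> 'b) \<Rightarrow>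
     nat \<Rightarrow> 'b list \<Rightarrow> 'a list \<Rightarrow> (nat \<Rightarrow> 'b list \<Rightarrow> 'a list \<Rightarrow> 'a pmf) \<Rightarrow> ereal" where
  "cond_expected_work M kT oi X Y i ys xs Q =
     ereal_expectation (uniform_measure M (context_event M X Y i ys xs)) (work kT oi X Y Q i)"

definition expected_total_work ::
    "'w measure \<Rightarrow> real \<Rightarrow> (nat \<Rightarrow> 'a list \<Rightarrow> real) \<Rightarrow> (nat \<Rightarrow> 'w \<Rightarrow> 'a) \<Rightarrow> (nat \<Rightarrow> 'w \<Rightarrow> 'b) \<Rightarrow>
     nat \<Rightarrow> (nat \<Rightarrow> 'b list \<Rightarrow> 'a list \<Rightarrow> 'a pmf) \<Rightarrow> ereal" where
  "expected_total_work M kT oi X Y n Q =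
     ereal_expectation M (\<lambda>\<omega>. \<Sum>i=1..n. work kT oi X Y Q i \<omega>)"

definition max_work_causal ::
    "'w measure \<Rightarrow> real \<Rightarrow> (nat \<Rightarrow> 'a list \<Rightarrow> real) \<Rightarrow> (nat \<Rightarrow> 'a set) \<Rightarrow>
     (nat \<Rightarrow> 'w \<Rightarrow> 'a) \<Rightarrow> (nat \<Rightarrow> 'w \<Rightarrow> 'b) \<Rightarrow> nat \<Rightarrow> ereal" where
  "max_work_causal M kT oi A X Y n =
     (SUP Q \<in> causal_strategies n A. expected_total_work M kT oi X Y n Q)"

definition max_work_blind ::
    "'w measure \<Rightarrow> real \<Rightarrow> (nat \<Rightarrow> 'a list \<Rightarrow> real) \<Rightarrow> (nat \<Rightarrow> 'a set) \<Rightarrow>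
     (nat \<Rightarrow> 'w \<Rightarrow> 'a) \<Rightarrow> (nat \<Rightarrow> 'w \<Rightarrow> 'b) \<Rightarrow> nat \<Rightarrow> ereal" where
  "max_work_blind M kT oi A X Y n =
     (SUP Q \<in> blind_strategies n A. expected_total_work M kT oi X Y n Q)"

text \<open>Base \<open>exp 1\<close>: entropies and informations are in nats.\<close>

definition causal_cond_entropy ::
    "'w measure \<Rightarrow> (nat \<Rightarrow> 'w \<Rightarrow> 'a) \<Rightarrow> (nat \<Rightarrow> 'w \<Rightarrow> 'b) \<Rightarrow> nat \<Rightarrow> real" where
  "causal_cond_entropy M X Y i =
     information_space.conditional_entropy_Pow M (exp 1)
       (X i) (\<lambda>\<omega>. (hist Y i \<omega>, hist X (i - 1) \<omega>))"

lemma causal_cond_entropy_eq: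
  fixes M X Y i
  defines "Z \<equiv> \<lambda>\<omega>. (hist Y i \<omega>, hist X (i - 1) \<omega>)"
  assumes "prob_space M" and X: "simple_function M (X i)" and Z: "simple_function M Z"
  shows "causal_cond_entropy M X Y i =
    - (\<Sum>(x, z) \<in> (\<lambda>\<omega>. (X i \<omega>, Z \<omega>)) ` space M.
         \<P>(\<omega> in M. X i \<omega> = x \<and> Z \<omega> = z) * ln (\<P>(\<omega> in M. X i \<omega> = x \<bar> Z \<omega> = z)))"
proof -
  interpret prob_space M by fact
  interpret information_space M "exp 1" by standard simp
  have Z': "simple_distributed M Z (\<lambda>z. measure M (Z -` {z} \<inter> space M))"
    by (rule simple_distributedI[OF Z]) auto
  have XZ': "simple_distributed M (\<lambda>\<omega>. (X i \<omega>, Z \<omega>))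
      (\<lambda>p. measure M ((\<lambda>\<omega>. (X i \<omega>, Z \<omega>)) -` {p} \<inter> space M))"
    by (rule simple_distributedI[OF simple_function_Pair[OF X Z]]) auto
  have a: "(\<lambda>\<omega>. (X i \<omega>, Z \<omega>)) -` {(x, z)} \<inter> space M = {\<omega> \<in> space M. X i \<omega> = x \<and> Z \<omega> = z}"
    for x z by auto
  have b: "Z -` {z} \<inter> space M = {\<omega> \<in> space M. Z \<omega> = z}" for z by auto
  show ?thesis
    unfolding causal_cond_entropy_def Z_def[symmetric] conditional_entropy_eq[OF Z' XZ']
    by (simp add: a b cond_prob_def log_def)
qed

definition directed_information ::
    "'w measure \<Rightarrow> (nat \<Rightarrow> 'w \<Rightarrow> 'b) \<Rightarrow> (nat \<Rightarrow> 'w \<Rightarrow> 'a) \<Rightarrow> nat \<Rightarrow> real" where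
  "directed_information M Y X n =
     (\<Sum>i=1..n. information_space.conditional_mutual_information_Pow M (exp 1)
        (X i) (hist Y i) (hist X (i - 1)))"

end

theory Submission
  imports Defs
begin

text \<open>
  Gibbs' inequality conditionally on the controller's knowledge \<open>V\<close>: if \<open>p\<close> is the conditional
  likelihood of the state \<open>U\<close> given \<open>V\<close> and \<open>q\<close> the chosen one, then
  \<open>E[ln (q / p)] \<le> E[q / p] - 1 \<le> 0\<close>, with equality only if \<open>q = p\<close> almost surely.  Applied to
  \<open>V = (Y\<^sup>i, X\<^sup>i\<^sup>-\<^sup>1)\<close> this solves the causal problem.  A controller without measurements is a
  causal controller whose measurements are constant, so the same result solves the blind problem,
  and the gain is a sum of differences \<open>E[ln P(X\<^sub>i|Y\<^sup>i,X\<^sup>i\<^sup>-\<^sup>1)] - E[ln P(X\<^sub>i|X\<^sup>i\<^sup>-\<^sup>1)]\<close>.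
\<close>

text \<open>\<open>U\<close> and \<open>V\<close> are left general: \<open>V\<close> will be the
  controller's knowledge, the past states alone, or the constant \<open>()\<close>. At a null value
  of \<open>V\<close> the division by zero makes the likelihood 0.\<close>

definition cond_lik :: "'w measure \<Rightarrow> ('w \<Rightarrow> 'u) \<Rightarrow> ('w \<Rightarrow> 'v) \<Rightarrow> 'u \<Rightarrow> 'v \<Rightarrow> real" where
  "cond_lik M U V u v = \<P>(\<omega> in M. U \<omega> = u \<bar> V \<omega> = v)"

section \<open>Simple random variables and their expectations\<close>

lemma (in finite_measure) integrable_simple_function [intro]:
  fixes f :: "'a \<Rightarrow> real"
  assumes "simple_function M f"
  shows "integrable M f"
proof -
  have "finite ((\<lambda>\<omega>. norm (f \<omega>)) ` space M)"
    using finite_imageI[OF simple_functionD(1)[OF assms], of norm] by (simp add: image_image)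
  then have "norm (f \<omega>) \<le> Max ((\<lambda>\<omega>. norm (f \<omega>)) ` space M)" if "\<omega> \<in> space M" for \<omega>
    using that by (intro Max_ge) auto
  then show ?thesis
    by (intro integrable_const_bound AE_I2 borel_measurable_simple_function[OF assms])
qed

lemma simple_event:
  assumes "simple_function M W"
  shows "{\<omega> \<in> space M. P (W \<omega>)} \<in> sets M"
proof -
  have "W -` {w. P w} \<inter> space M \<in> sets M" by (rule simple_functionD(2)[OF assms])
  also have "W -` {w. P w} \<inter> space M = {\<omega> \<in> space M. P (W \<omega>)}" by auto
  finally show ?thesis .
qed

lemma (in prob_space) simple_distributed_prob:
  assumes "simple_function M W"
  shows "simple_distributed M W (\<lambda>w. prob {\<omega> \<in> space M. W \<omega> = w})"
  by (rule simple_distributedI[OF assms]) (auto intro!: arg_cong[where f = prob])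

text \<open>The bridge from integrals to the finite sums in which entropy and information are
  given.\<close>

lemma (in prob_space) expectation_simple:
  fixes f :: "'b \<Rightarrow> real"
  assumes W: "simple_function M W"
  shows "expectation (\<lambda>\<omega>. f (W \<omega>)) =
    (\<Sum>w\<in>W ` space M. prob {\<omega> \<in> space M. W \<omega> = w} * f w)"
proof -
  let ?S = "\<lambda>w. {\<omega> \<in> space M. W \<omega> = w}"
  have fin: "finite (W ` space M)" using simple_functionD(1)[OF W] .
  have S: "?S w \<in> sets M" for w by (rule simple_event[OF W])
  have "expectation (\<lambda>\<omega>. f (W \<omega>)) =
      expectation (\<lambda>\<omega>. \<Sum>w\<in>W ` space M. f w * indicator (?S w) \<omega>)"
  proof (rule Bochner_Integration.integral_cong[OF refl])
    fix \<omega> assume \<omega>: "\<omega> \<in> space M"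
    have "(\<Sum>w\<in>W ` space M. f w * indicator (?S w) \<omega>) =
        (\<Sum>w\<in>W ` space M. if w = W \<omega> then f w else 0)"
      using \<omega> by (intro sum.cong) (auto simp: indicator_def)
    then show "f (W \<omega>) = (\<Sum>w\<in>W ` space M. f w * indicator (?S w) \<omega>)"
      using fin \<omega> by simp
  qed
  also have "\<dots> = (\<Sum>w\<in>W ` space M. expectation (\<lambda>\<omega>. f w * indicator (?S w) \<omega>))"
    using S by (intro Bochner_Integration.integral_sum)
      (auto intro!: integrable_real_indicator integrable_mult_right simp: emeasure_eq_measure)
  also have "\<dots> = (\<Sum>w\<in>W ` space M. prob (?S w) * f w)"
    using S by (intro sum.cong) (auto simp: mult.commute)
  finally show ?thesis .
qed

text \<open>A simple function has finitely many values, so its null level sets have a null union.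
  This licenses the divisions and logarithms of probabilities that follow.\<close>

lemma (in prob_space) AE_simple_pos:
  assumes W: "simple_function M W"
  shows "AE \<omega> in M. 0 < prob {\<omega>' \<in> space M. W \<omega>' = W \<omega>}"
proof -
  have "AE \<omega> in M. \<forall>w\<in>W ` space M. prob {\<omega>' \<in> space M. W \<omega>' = w} = 0 \<longrightarrow> W \<omega> \<noteq> w"
  proof (rule AE_finite_allI[OF simple_functionD(1)[OF W]])
    fix w
    show "AE \<omega> in M. prob {\<omega>' \<in> space M. W \<omega>' = w} = 0 \<longrightarrow> W \<omega> \<noteq> w"
    proof (cases "prob {\<omega>' \<in> space M. W \<omega>' = w} = 0")
      case True
      then show ?thesis
        using simple_event[OF W, of "\<lambda>v. v = w"]
        by (intro AE_I[where N = "{\<omega>' \<in> space M. W \<omega>' = w}"]) (auto simp: emeasure_eq_measure)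
    qed simp
  qed
  then show ?thesis
    using AE_space by eventually_elim (force simp: zero_less_measure_iff)
qed

section \<open>Conditional likelihoods and Gibbs' inequality\<close>

lemma (in prob_space) prob_pair_le:
  assumes "simple_function M U" "simple_function M V"
  shows "prob {\<omega> \<in> space M. (U \<omega>, V \<omega>) = (u, v)} \<le> prob {\<omega> \<in> space M. V \<omega> = v}"
  using simple_event[OF assms(2)] by (intro finite_measure_mono) auto

lemma (in prob_space) cond_lik_eq:
  "cond_lik M U V u v =
     prob {\<omega> \<in> space M. (U \<omega>, V \<omega>) = (u, v)} / prob {\<omega> \<in> space M. V \<omega> = v}"
  by (simp add: cond_lik_def cond_prob_def)

lemma (in prob_space) AE_cond_lik_pos:
  assumes U: "simple_function M U" and V: "simple_function M V"
  shows "AE \<omega> in M. 0 < cond_lik M U V (U \<omega>) (V \<omega>)"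
  using AE_simple_pos[OF simple_function_Pair[OF U V]] AE_simple_pos[OF V]
  by eventually_elim (simp add: cond_lik_eq)

text \<open>Weighting \<open>q / p\<close> by the joint probability cancels \<open>p\<close> and
  leaves \<open>P(V = v) q(u|v)\<close>, whose total is at most 1. Equality can fail:
  \<open>q v\<close> may have mass on null pairs or outside the range of \<open>U\<close>.\<close>

lemma (in prob_space) expectation_likelihood_ratio_le:
  fixes q :: "'v \<Rightarrow> 'u pmf"
  assumes U: "simple_function M U" and V: "simple_function M V"
  shows "expectation (\<lambda>\<omega>. pmf (q (V \<omega>)) (U \<omega>) / cond_lik M U V (U \<omega>) (V \<omega>)) \<le> 1"
proof -
  let ?PV = "\<lambda>v. prob {\<omega> \<in> space M. V \<omega> = v}"
  let ?P = "\<lambda>u v. prob {\<omega> \<in> space M. (U \<omega>, V \<omega>) = (u, v)}"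
  note UV = simple_function_Pair[OF U V]
  have finU: "finite (U ` space M)" and finV: "finite (V ` space M)"
    using simple_functionD(1) U V by auto
  have "expectation (\<lambda>\<omega>. pmf (q (V \<omega>)) (U \<omega>) / cond_lik M U V (U \<omega>) (V \<omega>)) =
    (\<Sum>w\<in>(\<lambda>\<omega>. (U \<omega>, V \<omega>)) ` space M. prob {\<omega> \<in> space M. (U \<omega>, V \<omega>) = w} *
        (case w of (u, v) \<Rightarrow> pmf (q v) u / cond_lik M U V u v))"
    using expectation_simple[OF UV, of "\<lambda>(u, v). pmf (q v) u / cond_lik M U V u v"]
    by simp
  also have "\<dots> \<le> (\<Sum>w\<in>(\<lambda>\<omega>. (U \<omega>, V \<omega>)) ` space M. case w of (u, v) \<Rightarrow> ?PV v * pmf (q v) u)"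
  proof (rule sum_mono, clarify)
    fix u v
    \<comment> \<open>A null pair makes the left side 0; otherwise \<open>V = v\<close> is not null
      by \<open>prob_pair_le\<close>, and the two sides agree.\<close>
    show "?P u v * (pmf (q v) u / cond_lik M U V u v) \<le> ?PV v * pmf (q v) u"
      using prob_pair_le[OF U V, of u v] by (cases "?P u v = 0") (simp_all add: cond_lik_eq)
  qed
  also have "\<dots> \<le> (\<Sum>w\<in>U ` space M \<times> V ` space M. case w of (u, v) \<Rightarrow> ?PV v * pmf (q v) u)"
    using finU finV by (intro sum_mono2) auto
  also have "\<dots> = (\<Sum>v\<in>V ` space M. ?PV v * (\<Sum>u\<in>U ` space M. pmf (q v) u))"
    by (subst sum.cartesian_product[symmetric], subst sum.swap) (simp add: sum_distrib_left)
  also have "\<dots> \<le> (\<Sum>v\<in>V ` space M. ?PV v * 1)"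
  proof (intro sum_mono mult_left_mono)
    fix v
    show "(\<Sum>u\<in>U ` space M. pmf (q v) u) \<le> 1"
      using measure_measure_pmf_finite[OF finU, of "q v"] measure_pmf.prob_le_1[of "q v"] by metis
  qed auto
  also have "\<dots> = 1"
    using expectation_simple[OF V, of "\<lambda>_. 1"] by (simp add: prob_space)
  finally show ?thesis .
qed

text \<open>The real \<open>ln\<close> cannot take the value -\<infinity>, so \<open>pos\<close>
  confines the inequality to choices that almost surely give mass to the realized state; the others
  are treated separately as work -\<infinity>.\<close>

lemma (in prob_space) conditional_Gibbs:
  fixes q :: "'v \<Rightarrow> 'u pmf"
  assumes U: "simple_function M U" and V: "simple_function M V"
    and pos: "AE \<omega> in M. 0 < pmf (q (V \<omega>)) (U \<omega>)"
  shows conditional_Gibbs_le: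
      "expectation (\<lambda>\<omega>. ln (pmf (q (V \<omega>)) (U \<omega>))) \<le>
       expectation (\<lambda>\<omega>. ln (cond_lik M U V (U \<omega>) (V \<omega>)))" (is "?lq \<le> ?lp")
    and conditional_Gibbs_eq:
      "expectation (\<lambda>\<omega>. ln (pmf (q (V \<omega>)) (U \<omega>))) =
       expectation (\<lambda>\<omega>. ln (cond_lik M U V (U \<omega>) (V \<omega>))) \<Longrightarrow>
       AE \<omega> in M. pmf (q (V \<omega>)) (U \<omega>) = cond_lik M U V (U \<omega>) (V \<omega>)"
proof -
  let ?q = "\<lambda>\<omega>. pmf (q (V \<omega>)) (U \<omega>)" and ?p = "\<lambda>\<omega>. cond_lik M U V (U \<omega>) (V \<omega>)"
  \<comment> \<open>\<open>D\<close> is the gap in \<open>ln r \<le> r - 1\<close> at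
    \<open>r = q / p\<close>: nonnegative, and 0 only for \<open>r = 1\<close>. The two logarithms
    are kept apart so that its expectation splits by linearity.\<close>
  define D where "D \<omega> = ?q \<omega> / ?p \<omega> - 1 - (ln (?q \<omega>) - ln (?p \<omega>))" for \<omega>
  have int: "integrable M (\<lambda>\<omega>. f (U \<omega>) (V \<omega>))" for f :: "'u \<Rightarrow> 'v \<Rightarrow> real"
    by (rule integrable_simple_function[OF simple_function_compose2[OF U V]])
  have D_simple: "integrable M D"
    unfolding D_def by (rule int)
  have D_AE: "AE \<omega> in M. 0 \<le> D \<omega> \<and> (D \<omega> = 0 \<longrightarrow> ?q \<omega> = ?p \<omega>)"
    using pos AE_cond_lik_pos[OF U V]
  proof eventually_elim
    case (elim \<omega>)
    then have r: "0 < ?q \<omega> / ?p \<omega>" and D: "D \<omega> = ?q \<omega> / ?p \<omega> - 1 - ln (?q \<omega> / ?p \<omega>)"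
      by (simp_all add: D_def ln_div)
    show ?case
      using ln_le_minus_one[OF r] ln_eq_minus_one[OF r] elim unfolding D by auto
  qed
  have ED: "expectation D = expectation (\<lambda>\<omega>. ?q \<omega> / ?p \<omega>) - 1 - (?lq - ?lp)"
    unfolding D_def
    by (subst Bochner_Integration.integral_diff Bochner_Integration.integral_diff; (rule int)?)+
       (simp add: prob_space)
  have ED_le: "expectation D \<le> ?lp - ?lq"
    using expectation_likelihood_ratio_le[OF U V, of q] ED by simp
  have "0 \<le> expectation D"
    using D_AE by (intro integral_nonneg_AE) auto
  with ED_le show "?lq \<le> ?lp" by simp
  assume "?lq = ?lp"
  with ED_le \<open>0 \<le> expectation D\<close> have "expectation D = 0" by simp
  then have "AE \<omega> in M. D \<omega> = 0"
    using D_AE by (subst (asm) integral_nonneg_eq_0_iff_AE[OF D_simple]) auto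
  with D_AE show "AE \<omega> in M. ?q \<omega> = ?p \<omega>" by eventually_elim auto
qed

section \<open>Expected logarithms: entropy, information, extended-real values\<close>

lemma (in prob_space) conditional_entropy_eq_expectation:
  assumes U: "simple_function M U" and V: "simple_function M V"
  shows "information_space.conditional_entropy_Pow M (exp 1) U V =
    - expectation (\<lambda>\<omega>. ln (cond_lik M U V (U \<omega>) (V \<omega>)))"
proof -
  interpret information_space M "exp 1" by standard simp
  show ?thesis
    using expectation_simple[OF simple_function_Pair[OF U V], of "\<lambda>(u, v). ln (cond_lik M U V u v)"]
    by (simp add: 
        conditional_entropy_eq[OF simple_distributed_prob[OF V]
          simple_distributed_prob[OF simple_function_Pair[OF U V]]] cond_lik_eq log_def split_def prod_eq_iff)
qed

text \<open>The ratio \<open>P(u,v,w) P(w) / (P(u,w) P(v,w))\<close> under the logarithm is the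
  quotient of the likelihoods of \<open>u\<close> given \<open>(v, w)\<close> and given
  \<open>w\<close>. So information is the gain in expected log-likelihood from also knowing
  \<open>V\<close>.\<close>

lemma (in prob_space) conditional_mutual_information_eq_expectation:
  assumes U: "simple_function M U" and V: "simple_function M V" and W: "simple_function M W"
  shows "information_space.conditional_mutual_information_Pow M (exp 1) U V W =
    expectation (\<lambda>\<omega>. ln (cond_lik M U (\<lambda>\<omega>. (V \<omega>, W \<omega>)) (U \<omega>) (V \<omega>, W \<omega>))) -
    expectation (\<lambda>\<omega>. ln (cond_lik M U W (U \<omega>) (W \<omega>)))"
proof -
  interpret information_space M "exp 1" by standard simp
  note VW = simple_function_Pair[OF V W] and UW = simple_function_Pair[OF U W]
  note UVW = simple_function_Pair[OF U VW]
  let ?P = "\<lambda>R r. prob {\<omega> \<in> space M. R \<omega> = r}"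
  let ?UVW = "\<lambda>\<omega>. (U \<omega>, V \<omega>, W \<omega>)" and ?VW = "\<lambda>\<omega>. (V \<omega>, W \<omega>)" and ?UW = "\<lambda>\<omega>. (U \<omega>, W \<omega>)"
  let ?f = "\<lambda>u v w. ?P ?UVW (u, v, w) / (?P ?UW (u, w) * (?P ?VW (v, w) / ?P W w))"
  have "information_space.conditional_mutual_information_Pow M (exp 1) U V W =
      expectation (\<lambda>\<omega>. ln (?f (U \<omega>) (V \<omega>) (W \<omega>)))"
    using expectation_simple[OF UVW, of "\<lambda>(u, v, w). ln (?f u v w)"]
    by (simp add: conditional_mutual_information_eq[OF
          simple_distributed_prob[OF W] simple_distributed_prob[OF VW]
          simple_distributed_prob[OF UW] simple_distributed_prob[OF UVW]]
        log_def split_def prod_eq_iff)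
  also have "\<dots> = expectation (\<lambda>\<omega>. ln (cond_lik M U ?VW (U \<omega>) (?VW \<omega>)) -
      ln (cond_lik M U W (U \<omega>) (W \<omega>)))"
  proof (rule integral_cong_AE)
    show "AE \<omega> in M. ln (?f (U \<omega>) (V \<omega>) (W \<omega>)) =
      ln (cond_lik M U ?VW (U \<omega>) (?VW \<omega>)) - ln (cond_lik M U W (U \<omega>) (W \<omega>))"
      \<comment> \<open>All four probabilities are positive almost surely; this lets the fractions
        cancel and the logarithm of the quotient split.\<close>
      using AE_simple_pos[OF UVW] AE_simple_pos[OF VW] AE_simple_pos[OF UW] AE_simple_pos[OF W]
      by eventually_elim (simp add: cond_lik_eq ln_div ln_mult)
  qed (rule borel_measurable_simple_function, rule simple_function_compose1[OF UVW,
        of "\<lambda>(u, v, w). ln (?f u v w)", simplified split_conv]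
      simple_function_compose1[OF UVW, of "\<lambda>(u, v, w). ln (cond_lik M U ?VW u (v, w)) -
        ln (cond_lik M U W u w)", simplified split_conv])+
  also have "\<dots> = expectation (\<lambda>\<omega>. ln (cond_lik M U ?VW (U \<omega>) (?VW \<omega>))) -
      expectation (\<lambda>\<omega>. ln (cond_lik M U W (U \<omega>) (W \<omega>)))"
    by (intro Bochner_Integration.integral_diff integrable_simple_function
        simple_function_compose2[OF U VW, of "\<lambda>u v. ln (cond_lik M U ?VW u v)"]
        simple_function_compose2[OF U W, of "\<lambda>u w. ln (cond_lik M U W u w)"])
  finally show ?thesis .
qed

text \<open>With finitely many values, the expectation is -\<infinity> as soon as some
  \<open>f i\<close> is nonpositive with positive probability; otherwise all logarithms are real
  almost surely and linearity applies.\<close>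

lemma (in prob_space) ereal_expectation_sum_ln:
  fixes f :: "'i \<Rightarrow> 'a \<Rightarrow> real"
  assumes I: "finite I" and c: "0 < c" and f: "\<And>i. i \<in> I \<Longrightarrow> simple_function M (f i)"
  shows "ereal_expectation M (\<lambda>\<omega>. \<Sum>i\<in>I. ereal c * ln_ereal (f i \<omega>)) =
    (if AE \<omega> in M. \<forall>i\<in>I. 0 < f i \<omega>
     then ereal (c * (\<Sum>i\<in>I. expectation (\<lambda>\<omega>. ln (f i \<omega>)))) else - \<infinity>)"
proof (cases "AE \<omega> in M. \<forall>i\<in>I. 0 < f i \<omega>")
  case True
  have lnf: "integrable M (\<lambda>\<omega>. ln (f i \<omega>))" if "i \<in> I" for i
    using f[OF that] by (intro integrable_simple_function) (rule simple_function_compose1)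
  have AE: "AE \<omega> in M. (\<Sum>i\<in>I. ereal c * ln_ereal (f i \<omega>)) = ereal (\<Sum>i\<in>I. c * ln (f i \<omega>))"
    using True by eventually_elim (subst sum_ereal[symmetric], intro sum.cong; simp add: ln_ereal_def)
  have "ereal_expectation M (\<lambda>\<omega>. \<Sum>i\<in>I. ereal c * ln_ereal (f i \<omega>)) =
      ereal_expectation M (\<lambda>\<omega>. ereal (\<Sum>i\<in>I. c * ln (f i \<omega>)))"
    unfolding ereal_expectation_def
    by (intro arg_cong2[where f = "(-)"] arg_cong[where f = enn2ereal] nn_integral_cong_AE)
       (use AE in \<open>eventually_elim, simp\<close>)+
  also have "\<dots> = ereal (\<Sum>i\<in>I. c * expectation (\<lambda>\<omega>. ln (f i \<omega>)))"
    by (subst ereal_expectation_ereal) (use lnf in auto)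
  finally show ?thesis using True by (simp add: sum_distrib_left)
next
  case False
  let ?h = "\<lambda>\<omega>. \<Sum>i\<in>I. ereal c * ln_ereal (f i \<omega>)"
  have h: "simple_function M (\<lambda>\<omega>. g (?h \<omega>))" for g :: "ereal \<Rightarrow> ennreal"
    by (rule simple_function_compose1[where f = ?h and g = g], rule simple_function_sum,
        rule simple_function_compose1[where g = "\<lambda>r. ereal c * ln_ereal r"], rule f)
  have less: "ereal c * ln_ereal r < \<infinity>" for r
    using c by (auto simp: ln_ereal_def)
  have "e2ennreal (?h \<omega>) < \<infinity>" for \<omega>
  proof -
    have "?h \<omega> \<noteq> \<infinity>" using less by (auto simp: sum_Pinfty)
    then show ?thesis by (cases "?h \<omega>") (auto simp: e2ennreal_neg)
  qed
  \<comment> \<open>The positive part must be finite: \<open>ereal\<close> evaluates \<infinity> -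
    \<infinity> to \<infinity>, which would hide the infinite loss.\<close>
  then have pos: "(\<integral>\<^sup>+ \<omega>. e2ennreal (?h \<omega>) \<partial>M) < \<infinity>"
    by (intro nn_integral_bound_simple_function h[of e2ennreal]) (auto simp: emeasure_eq_measure)
  have "(\<integral>\<^sup>+ \<omega>. e2ennreal (- ?h \<omega>) \<partial>M) = \<infinity>"
  proof (rule ccontr)
    assume "(\<integral>\<^sup>+ \<omega>. e2ennreal (- ?h \<omega>) \<partial>M) \<noteq> \<infinity>"
    then have "AE \<omega> in M. e2ennreal (- ?h \<omega>) \<noteq> \<infinity>"
      by (intro nn_integral_noteq_infinite borel_measurable_simple_function
          h[of "\<lambda>x. e2ennreal (- x)"])
    then have "AE \<omega> in M. \<forall>i\<in>I. 0 < f i \<omega>"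
    proof eventually_elim
      case (elim \<omega>)
      show ?case
      proof (rule ccontr)
        assume "\<not> (\<forall>i\<in>I. 0 < f i \<omega>)"
        then obtain i where i: "i \<in> I" "\<not> 0 < f i \<omega>" by auto
        then have "ereal c * ln_ereal (f i \<omega>) = - \<infinity>"
          using c by (simp add: ln_ereal_def)
        \<comment> \<open>In \<open>ereal\<close> a summand \<infinity> would absorb -\<infinity>,
          so the remaining terms must be shown to avoid it.\<close>
        moreover have "(\<Sum>j\<in>I - {i}. ereal c * ln_ereal (f j \<omega>)) \<noteq> \<infinity>"
          using less by (simp add: sum_Pinfty less_top[symmetric])
        ultimately have "?h \<omega> = - \<infinity>"
          using I i by (subst sum.remove[of _ i]) auto
        with elim show False by simp
      qed
    qed
    with False show False by simp
  qed
  with pos False show ?thesis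
    by (cases "\<integral>\<^sup>+ \<omega>. e2ennreal (?h \<omega>) \<partial>M") (auto simp: ereal_expectation_def)
qed

text \<open>\<open>q\<close> already spends its whole mass 1 on the support of \<open>p\<close>.
  Almost sure equality compares distributions only at values of positive probability, and this
  recovers full equality.\<close>

lemma pmf_eqI_on_set_pmf:
  assumes fin: "finite (set_pmf p)" and eq: "\<And>x. x \<in> set_pmf p \<Longrightarrow> pmf q x = pmf p x"
  shows "q = p"
proof (rule pmf_eqI)
  fix x
  have "measure_pmf.prob q (set_pmf p) = (\<Sum>x\<in>set_pmf p. pmf p x)"
    using eq by (simp add: measure_measure_pmf_finite[OF fin])
  also have "\<dots> = 1" by (rule sum_pmf_eq_1[OF fin]) simp
  finally have "set_pmf q \<subseteq> set_pmf p"
    by (auto simp: measure_pmf.prob_eq_1 AE_measure_pmf_iff)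
  then show "pmf q x = pmf p x"
    using eq by (cases "x \<in> set_pmf p") (auto simp: set_pmf_iff)
qed

section \<open>Histories and the work extraction model\<close>

lemma hist_Suc: "hist Z (Suc k) \<omega> = hist Z k \<omega> @ [Z (Suc k) \<omega>]"
  by (simp add: hist_def)

lemma simple_function_hist:
  assumes "\<And>j. j \<in> {1..k} \<Longrightarrow> simple_function M (Z j)"
  shows "simple_function M (hist Z k)"
  using assms
proof (induction k)
  case 0
  then show ?case by (simp add: hist_def[abs_def])
next
  case (Suc k)
  have "simple_function M (\<lambda>\<omega>. hist Z k \<omega> @ [Z (Suc k) \<omega>])"
    using Suc by (intro simple_function_compose2[where h = "\<lambda>z x. z @ [x]"]) auto
  then show ?case by (simp add: hist_Suc[abs_def])
qed

lemma map_in_listset: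
  "(\<And>j. j \<in> set js \<Longrightarrow> f j \<in> S j) \<Longrightarrow> map f js \<in> listset (map S js)"
  by (induction js) (auto simp: set_Cons_def)

text \<open>A locale, since its results are needed twice: with the real measurements, and with
  constant ones, which stand for the blind controller.\<close>

locale work_extraction = prob_space M
  for M :: "'w measure" +
  fixes n :: nat
    and X :: "nat \<Rightarrow> 'w \<Rightarrow> 'a" and A :: "nat \<Rightarrow> 'a set"
    and Y :: "nat \<Rightarrow> 'w \<Rightarrow> 'b" and B :: "nat \<Rightarrow> 'b set"
    and kT :: real
    and oi :: "nat \<Rightarrow> 'a list \<Rightarrow> real"
  assumes finite_A: "\<And>i. i \<in> {1..n} \<Longrightarrow> finite (A i)"
    and finite_B: "\<And>i. i \<in> {1..n} \<Longrightarrow> finite (B i)"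
    and X: "\<And>i. i \<in> {1..n} \<Longrightarrow> X i \<in> measurable M (count_space (A i))"
    and Y: "\<And>i. i \<in> {1..n} \<Longrightarrow> Y i \<in> measurable M (count_space (B i))"
    and kT: "0 < kT"
    and oi: "\<And>i xs. i \<in> {1..n} \<Longrightarrow> xs \<in> listset (map A [1..<Suc i]) \<Longrightarrow> 0 < oi i xs"
begin

text \<open>The knowledge at cycle \<open>i\<close> as one variable, so that the general lemmas
  apply with it as \<open>V\<close>. For \<open>i = 1\<close> the state part is the empty
  list.\<close>

definition know :: "nat \<Rightarrow> 'w \<Rightarrow> 'b list \<times> 'a list" where
  "know i \<omega> = (hist Y i \<omega>, hist X (i - 1) \<omega>)"

text \<open>Off the contexts of positive probability \<open>cond_dist\<close> is not meaningful; a
  point mass on some element of the alphabet keeps the strategy admissible.\<close>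

definition opt :: "nat \<Rightarrow> 'b list \<Rightarrow> 'a list \<Rightarrow> 'a pmf" where
  "opt i ys xs = (if 0 < measure M (context_event M X Y i ys xs) then cond_dist M X Y i ys xs
     else return_pmf (SOME x. x \<in> A i))"

lemma simple_finite_range:
  assumes "finite C" and Z: "Z \<in> measurable M (count_space C)"
  shows "simple_function M Z"
proof -
  have "finite (Z ` space M)"
    using measurable_space[OF Z] by (intro finite_subset[OF _ assms(1)]) auto
  moreover have "Z -` {z} \<inter> space M \<in> sets M" if "z \<in> Z ` space M" for z
    using measurable_space[OF Z] that by (intro measurable_sets[OF Z]) auto
  ultimately show ?thesis by (simp add: simple_function_def)
qed

lemma simple_X: "i \<in> {1..n} \<Longrightarrow> simple_function M (X i)"
  using simple_finite_range[OF finite_A X] .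

lemma simple_Y: "i \<in> {1..n} \<Longrightarrow> simple_function M (Y i)"
  using simple_finite_range[OF finite_B Y] .

lemma simple_hist_X: "i \<le> n \<Longrightarrow> simple_function M (hist X i)"
  by (intro simple_function_hist simple_X) auto

lemma simple_hist_Y: "i \<le> n \<Longrightarrow> simple_function M (hist Y i)"
  by (intro simple_function_hist simple_Y) auto

lemma simple_know: "i \<in> {1..n} \<Longrightarrow> simple_function M (know i)"
  unfolding know_def[abs_def] by (intro simple_function_Pair simple_hist_X simple_hist_Y) auto

lemma X_in_A: "i \<in> {1..n} \<Longrightarrow> \<omega> \<in> space M \<Longrightarrow> X i \<omega> \<in> A i"
  using measurable_space[OF X] by auto

lemma oi_hist_pos: "i \<in> {1..n} \<Longrightarrow> \<omega> \<in> space M \<Longrightarrow> 0 < oi i (hist X i \<omega>)"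
  unfolding hist_def by (intro oi map_in_listset X_in_A) auto

lemma context_event_eq: "context_event M X Y i ys xs = {\<omega> \<in> space M. know i \<omega> = (ys, xs)}"
  by (auto simp: context_event_def know_def)

lemma context_event_sets: "i \<in> {1..n} \<Longrightarrow> context_event M X Y i ys xs \<in> sets M"
  unfolding context_event_eq by (rule simple_event[OF simple_know])

lemma pmf_cond_dist_eq:
  assumes i: "i \<in> {1..n}" and pos: "0 < measure M (context_event M X Y i ys xs)"
  shows "pmf (cond_dist M X Y i ys xs) x = cond_lik M (X i) (know i) x (ys, xs)"
  using pmf_cond_dist[OF prob_space_axioms finite_A[OF i] X[OF i] context_event_sets[OF i] pos]
  by (simp add: cond_lik_def know_def)

lemma set_cond_dist_subset:
  assumes i: "i \<in> {1..n}" and pos: "0 < measure M (context_event M X Y i ys xs)"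
  shows "set_pmf (cond_dist M X Y i ys xs) \<subseteq> A i"
proof
  fix x assume "x \<in> set_pmf (cond_dist M X Y i ys xs)"
  then have "cond_lik M (X i) (know i) x (ys, xs) \<noteq> 0"
    using pmf_cond_dist_eq[OF i pos] by (simp add: set_pmf_iff)
  then have "{\<omega> \<in> space M. (X i \<omega>, know i \<omega>) = (x, (ys, xs))} \<noteq> {}"
    unfolding cond_lik_eq by (metis measure_empty div_0)
  then show "x \<in> A i" using X_in_A[OF i] by auto
qed

lemma opt_eq_cond_dist:
  "0 < measure M (context_event M X Y i ys xs) \<Longrightarrow> opt i ys xs = cond_dist M X Y i ys xs"
  by (simp add: opt_def)

lemma opt_causal: "opt \<in> causal_strategies n A"
proof -
  \<comment> \<open>The alphabet is nonempty because \<open>X i\<close> maps the nonempty sample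
    space into it.\<close>
  have "(SOME x. x \<in> A i) \<in> A i" if "i \<in> {1..n}" for i
    using X_in_A[OF that] not_empty by (intro someI_ex[of "\<lambda>x. x \<in> A i"]) auto
  then show ?thesis
    using set_cond_dist_subset by (auto simp: causal_strategies_def opt_def set_return_pmf)
qed

text \<open>The realized context almost surely has positive probability, so the default branch of
  \<open>opt\<close> is met only on a null set.\<close>

lemma AE_pmf_opt:
  assumes i: "i \<in> {1..n}"
  shows "AE \<omega> in M. pmf (opt i (hist Y i \<omega>) (hist X (i - 1) \<omega>)) (X i \<omega>) =
    cond_lik M (X i) (know i) (X i \<omega>) (know i \<omega>)"
  using AE_simple_pos[OF simple_know[OF i]]
proof eventually_elim
  case (elim \<omega>)
  then have "0 < measure M (context_event M X Y i (hist Y i \<omega>) (hist X (i - 1) \<omega>))"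
    by (simp add: context_event_eq know_def[of i \<omega>])
  then show ?case
    using pmf_cond_dist_eq[OF i] by (simp add: opt_eq_cond_dist know_def[of i \<omega>])
qed

text \<open>The measure \<open>N\<close> is kept free: \<open>M\<close> itself with all cycles
  yields the total work, and \<open>M\<close> conditioned on a context with a single cycle yields
  the conditional work. As \<open>oi\<close> is positive on histories, the masses given by
  \<open>Q\<close> alone decide whether the value is -\<infinity>.\<close>

lemma ereal_expectation_work:
  assumes N: "prob_space N" "sets N = sets M" and I: "I \<subseteq> {1..n}"
  shows "ereal_expectation N (\<lambda>\<omega>. \<Sum>i\<in>I. work kT oi X Y Q i \<omega>) =
    (if AE \<omega> in N. \<forall>i\<in>I. 0 < pmf (Q i (hist Y i \<omega>) (hist X (i - 1) \<omega>)) (X i \<omega>)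
     then ereal (kT * (\<Sum>i\<in>I.
       (\<integral>\<omega>. ln (pmf (Q i (hist Y i \<omega>) (hist X (i - 1) \<omega>)) (X i \<omega>)) \<partial>N) -
       (\<integral>\<omega>. ln (oi i (hist X i \<omega>)) \<partial>N))) else - \<infinity>)"
proof -
  interpret N: prob_space N by fact
  have sp: "space N = space M" by (rule sets_eq_imp_space_eq[OF N(2)])
  have simpleN: "simple_function N f \<longleftrightarrow> simple_function M f" for f :: "'w \<Rightarrow> 'c"
    by (rule simple_function_cong_algebra) (simp_all add: N(2) sp)
  let ?p = "\<lambda>i \<omega>. pmf (Q i (hist Y i \<omega>) (hist X (i - 1) \<omega>)) (X i \<omega>)"
  let ?o = "\<lambda>i \<omega>. oi i (hist X i \<omega>)"
  have p: "simple_function M (?p i)" if "i \<in> I" for i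
  proof -
    have i: "i \<in> {1..n}" using I that by auto
    show ?thesis
      using simple_function_compose2[OF simple_know[OF i] simple_X[OF i],
          of "\<lambda>k x. pmf (Q i (fst k) (snd k)) x"]
      by (simp add: know_def)
  qed
  have o: "simple_function M (?o i)" if "i \<in> I" for i
    using I that by (intro simple_function_compose1[of M "hist X i" "oi i"] simple_hist_X) auto
  have opos: "0 < ?o i \<omega>" if "i \<in> I" "\<omega> \<in> space M" for i \<omega>
    using I that oi_hist_pos by auto
  have quot: "(\<integral>\<omega>. ln (?p i \<omega> / ?o i \<omega>) \<partial>N) = (\<integral>\<omega>. ln (?p i \<omega>) \<partial>N) - (\<integral>\<omega>. ln (?o i \<omega>) \<partial>N)"
    if i: "i \<in> I" and pos: "AE \<omega> in N. \<forall>i\<in>I. 0 < ?p i \<omega>" for i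
  proof -
    have lnp: "simple_function N (\<lambda>\<omega>. ln (?p i \<omega>))" and lno: "simple_function N (\<lambda>\<omega>. ln (?o i \<omega>))"
      and lnq: "simple_function N (\<lambda>\<omega>. ln (?p i \<omega> / ?o i \<omega>))"
      unfolding simpleN
      by (rule simple_function_compose1[OF p[OF i]], rule simple_function_compose1[OF o[OF i]],
          rule simple_function_compose2[OF p[OF i] o[OF i], of "\<lambda>a b. ln (a / b)"])
    have "(\<integral>\<omega>. ln (?p i \<omega> / ?o i \<omega>) \<partial>N) = (\<integral>\<omega>. ln (?p i \<omega>) - ln (?o i \<omega>) \<partial>N)"
    proof (rule integral_cong_AE)
      show "AE \<omega> in N. ln (?p i \<omega> / ?o i \<omega>) = ln (?p i \<omega>) - ln (?o i \<omega>)"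
        using pos AE_space
      proof eventually_elim
        case (elim \<omega>)
        then have "0 < ?p i \<omega>" "0 < ?o i \<omega>" using i opos sp by auto
        then show ?case by (simp add: ln_div)
      qed
    qed (use lnp lno lnq in \<open>auto intro!: borel_measurable_simple_function\<close>)
    also have "\<dots> = (\<integral>\<omega>. ln (?p i \<omega>) \<partial>N) - (\<integral>\<omega>. ln (?o i \<omega>) \<partial>N)"
      by (intro Bochner_Integration.integral_diff N.integrable_simple_function lnp lno)
    finally show ?thesis .
  qed
  have AE: "(AE \<omega> in N. \<forall>i\<in>I. 0 < ?p i \<omega> / ?o i \<omega>) \<longleftrightarrow> (AE \<omega> in N. \<forall>i\<in>I. 0 < ?p i \<omega>)"
    using opos by (intro AE_cong) (auto simp: sp zero_less_divide_iff dest: less_asym)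
  have "ereal_expectation N (\<lambda>\<omega>. \<Sum>i\<in>I. work kT oi X Y Q i \<omega>) =
    (if AE \<omega> in N. \<forall>i\<in>I. 0 < ?p i \<omega> / ?o i \<omega>
     then ereal (kT * (\<Sum>i\<in>I. \<integral>\<omega>. ln (?p i \<omega> / ?o i \<omega>) \<partial>N)) else - \<infinity>)"
    unfolding work_def
  proof (rule N.ereal_expectation_sum_ln[OF _ kT])
    show "finite I" using I finite_subset by blast
    show "simple_function N (\<lambda>\<omega>. ?p i \<omega> / ?o i \<omega>)" if "i \<in> I" for i
      unfolding simpleN by (rule simple_function_compose2[OF p[OF that] o[OF that]])
  qed
  then show ?thesis
    unfolding AE using quot by (auto intro!: sum.cong)
qed

section \<open>Optimal total work and the optimal choice in one context\<close>

definition optimal_value :: real where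
  "optimal_value = kT * (\<Sum>i=1..n. expectation (\<lambda>\<omega>. ln (cond_lik M (X i) (know i) (X i \<omega>) (know i \<omega>))) -
     expectation (\<lambda>\<omega>. ln (oi i (hist X i \<omega>))))"

lemma expected_total_work_opt: "expected_total_work M kT oi X Y n opt = ereal optimal_value"
proof -
  have "AE \<omega> in M. \<forall>i\<in>{1..n}. 0 < pmf (opt i (hist Y i \<omega>) (hist X (i - 1) \<omega>)) (X i \<omega>)"
  proof (rule AE_finite_allI)
    fix i assume i: "i \<in> {1..n}"
    show "AE \<omega> in M. 0 < pmf (opt i (hist Y i \<omega>) (hist X (i - 1) \<omega>)) (X i \<omega>)"
      using AE_pmf_opt[OF i] AE_cond_lik_pos[OF simple_X[OF i] simple_know[OF i]]
      by eventually_elim simp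
  qed simp
  moreover have "expectation (\<lambda>\<omega>. ln (pmf (opt i (hist Y i \<omega>) (hist X (i - 1) \<omega>)) (X i \<omega>))) =
      expectation (\<lambda>\<omega>. ln (cond_lik M (X i) (know i) (X i \<omega>) (know i \<omega>)))" if i: "i \<in> {1..n}" for i
  proof (rule integral_cong_AE)
    show "AE \<omega> in M. ln (pmf (opt i (hist Y i \<omega>) (hist X (i - 1) \<omega>)) (X i \<omega>)) =
        ln (cond_lik M (X i) (know i) (X i \<omega>) (know i \<omega>))"
      using AE_pmf_opt[OF i] by eventually_elim simp
    show "(\<lambda>\<omega>. ln (pmf (opt i (hist Y i \<omega>) (hist X (i - 1) \<omega>)) (X i \<omega>))) \<in> borel_measurable M"
      using simple_function_compose2[OF simple_know[OF i] simple_X[OF i],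
          of "\<lambda>k x. ln (pmf (opt i (fst k) (snd k)) x)"]
      by (intro borel_measurable_simple_function) (simp add: know_def)
    show "(\<lambda>\<omega>. ln (cond_lik M (X i) (know i) (X i \<omega>) (know i \<omega>))) \<in> borel_measurable M"
      by (intro borel_measurable_simple_function
          simple_function_compose2[OF simple_know[OF i] simple_X[OF i],
            of "\<lambda>k x. ln (cond_lik M (X i) (know i) x k)"])
  qed
  ultimately show ?thesis
    unfolding expected_total_work_def ereal_expectation_work[OF prob_space_axioms refl order_refl]
    by (simp add: optimal_value_def)
qed

text \<open>The processes do not depend on \<open>Q\<close>, so the cycles decouple and Gibbs'
  inequality bounds each summand separately. A choice that misses the realized state of some cycle
  with positive probability has value -\<infinity>.\<close>

lemma expected_total_work_le: "expected_total_work M kT oi X Y n Q \<le> ereal optimal_value"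
proof (cases "AE \<omega> in M. \<forall>i\<in>{1..n}. 0 < pmf (Q i (hist Y i \<omega>) (hist X (i - 1) \<omega>)) (X i \<omega>)")
  case True
  have "expectation (\<lambda>\<omega>. ln (pmf (Q i (hist Y i \<omega>) (hist X (i - 1) \<omega>)) (X i \<omega>))) \<le>
      expectation (\<lambda>\<omega>. ln (cond_lik M (X i) (know i) (X i \<omega>) (know i \<omega>)))" if i: "i \<in> {1..n}" for i
  proof -
    have "AE \<omega> in M. 0 < pmf (Q i (hist Y i \<omega>) (hist X (i - 1) \<omega>)) (X i \<omega>)"
      using True by eventually_elim (use i in blast)
    then show ?thesis
      using conditional_Gibbs_le[OF simple_X[OF i] simple_know[OF i], of "\<lambda>k. Q i (fst k) (snd k)"]
      by (simp add: know_def)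
  qed
  then show ?thesis
    unfolding expected_total_work_def ereal_expectation_work[OF prob_space_axioms refl order_refl]
      optimal_value_def
    using True kT by (auto intro!: mult_left_mono sum_mono)
next
  case False
  then show ?thesis
    unfolding expected_total_work_def ereal_expectation_work[OF prob_space_axioms refl order_refl]
    by simp
qed

lemma max_work_causal_eq: "max_work_causal M kT oi A X Y n = ereal optimal_value"
  unfolding max_work_causal_def
  by (intro antisym SUP_least expected_total_work_le SUP_upper2[OF opt_causal])
     (simp add: expected_total_work_opt)

text \<open>Each expected log-likelihood is minus a conditional entropy. The value itself is defined
  by likelihoods, which are convenient to subtract when two kinds of knowledge are compared.\<close>

lemma optimal_value_entropy:
  "optimal_value =
     - kT * (\<Sum>i=1..n. causal_cond_entropy M X Y i + expectation (\<lambda>\<omega>. ln (oi i (hist X i \<omega>))))"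
proof -
  have "causal_cond_entropy M X Y i =
      - expectation (\<lambda>\<omega>. ln (cond_lik M (X i) (know i) (X i \<omega>) (know i \<omega>)))" if i: "i \<in> {1..n}" for i
    using conditional_entropy_eq_expectation[OF simple_X[OF i] simple_know[OF i]]
    by (simp add: causal_cond_entropy_def know_def[abs_def])
  then show ?thesis
    by (simp add: optimal_value_def sum_negf[symmetric] flip: mult_minus_right)
qed

text \<open>Conditioned on the context the knowledge is constant, so the expected work depends on
  \<open>Q\<close> only through \<open>Q i ys xs\<close>, and Gibbs' inequality for trivial
  knowledge applies. Its equality case makes this distribution unique, while the other values of
  \<open>Q\<close> stay free among causal strategies.\<close>

lemma cond_expected_work_maximizer:
  assumes i: "i \<in> {1..n}" and pos: "0 < measure M (context_event M X Y i ys xs)"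
  shows "is_arg_max (cond_expected_work M kT oi X Y i ys xs) (\<lambda>Q'. Q' \<in> causal_strategies n A) Q \<longleftrightarrow>
    Q \<in> causal_strategies n A \<and> Q i ys xs = cond_dist M X Y i ys xs"
proof -
  let ?E = "context_event M X Y i ys xs" and ?p = "cond_dist M X Y i ys xs"
  let ?F = "cond_expected_work M kT oi X Y i ys xs"
  define N where "N = uniform_measure M ?E"
  have E: "?E \<in> sets M" by (rule context_event_sets[OF i])
  have E0: "emeasure M ?E \<noteq> 0" "emeasure M ?E \<noteq> \<infinity>"
    using pos by (simp_all add: emeasure_eq_measure)
  interpret N: prob_space N
    unfolding N_def by (rule prob_space_uniform_measure[OF E0])
  have setsN: "sets N = sets M" and spN: "space N = space M" by (simp_all add: N_def)
  have simpleN: "simple_function N f \<longleftrightarrow> simple_function M f" for f :: "'w \<Rightarrow> 'c"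
    by (rule simple_function_cong_algebra) (simp_all add: setsN spN)
  have AEN: "AE \<omega> in N. know i \<omega> = (ys, xs)"
    unfolding N_def by (rule AE_uniform_measureI[OF E]) (simp add: context_event_eq)
  have XN: "simple_function N (X i)" using simple_X[OF i] by (simp add: simpleN)
  \<comment> \<open>With constant knowledge \<open>()\<close> the likelihood of \<open>X i\<close>
    under \<open>N\<close> is just its distribution there, and this is \<open>cond_dist\<close> of
    the context.\<close>
  have lik: "cond_lik N (X i) (\<lambda>_. ()) x u = pmf ?p x" for x u
  proof -
    have S: "{\<omega> \<in> space M. X i \<omega> = x} \<in> sets M" by (rule simple_event[OF simple_X[OF i]])
    have "N.prob {\<omega> \<in> space M. X i \<omega> = x} = prob (?E \<inter> {\<omega> \<in> space M. X i \<omega> = x}) / prob ?E"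
      unfolding N_def by (rule measure_uniform_measure[OF E0 S])
    also have "?E \<inter> {\<omega> \<in> space M. X i \<omega> = x} = {\<omega> \<in> space M. X i \<omega> = x \<and> know i \<omega> = (ys, xs)}"
      by (auto simp: context_event_eq)
    finally show ?thesis
      using N.prob_space
      by (simp add: N.cond_lik_eq pmf_cond_dist_eq[OF i pos] cond_lik_eq spN context_event_eq)
  qed
  let ?pos = "\<lambda>q. AE \<omega> in N. 0 < pmf q (X i \<omega>)"
  let ?L = "\<lambda>q. N.expectation (\<lambda>\<omega>. ln (pmf q (X i \<omega>)))"
  have F: "?F Q = (if ?pos (Q i ys xs)
      then ereal (kT * (?L (Q i ys xs) - N.expectation (\<lambda>\<omega>. ln (oi i (hist X i \<omega>))))) else - \<infinity>)" for Q
  proof -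
    have "(AE \<omega> in N. \<forall>j\<in>{i}. 0 < pmf (Q j (hist Y j \<omega>) (hist X (j - 1) \<omega>)) (X j \<omega>)) \<longleftrightarrow>
        ?pos (Q i ys xs)"
      by (rule eventually_cong[OF AEN]) (simp add: know_def)
    moreover have "N.expectation (\<lambda>\<omega>. ln (pmf (Q i (hist Y i \<omega>) (hist X (i - 1) \<omega>)) (X i \<omega>))) =
        ?L (Q i ys xs)"
    proof (rule integral_cong_AE)
      show "AE \<omega> in N. ln (pmf (Q i (hist Y i \<omega>) (hist X (i - 1) \<omega>)) (X i \<omega>)) =
          ln (pmf (Q i ys xs) (X i \<omega>))"
        using AEN by eventually_elim (simp add: know_def)
      show "(\<lambda>\<omega>. ln (pmf (Q i (hist Y i \<omega>) (hist X (i - 1) \<omega>)) (X i \<omega>))) \<in> borel_measurable N"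
        using simple_function_compose2[OF simple_know[OF i] simple_X[OF i],
            of "\<lambda>k x. ln (pmf (Q i (fst k) (snd k)) x)"]
        by (intro borel_measurable_simple_function) (simp add: know_def simpleN)
      show "(\<lambda>\<omega>. ln (pmf (Q i ys xs) (X i \<omega>))) \<in> borel_measurable N"
        by (rule borel_measurable_simple_function[OF simple_function_compose1[OF XN]])
    qed
    ultimately show ?thesis
      using ereal_expectation_work[OF N.prob_space_axioms setsN, of "{i}" Q] i
      by (simp add: cond_expected_work_def N_def[symmetric])
  qed
  have posp: "?pos ?p"
    using N.AE_cond_lik_pos[OF XN, of "\<lambda>_. ()"] by (simp add: lik)
  have le: "?F Q \<le> ?F Q'" if "Q' i ys xs = ?p" for Q Q'
    using N.conditional_Gibbs_le[OF XN, of "\<lambda>_. ()" "\<lambda>_. Q i ys xs"] posp kT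
    by (simp add: F that lik)
  have eq: "Q i ys xs = ?p" if "?F Q = ?F Q'" "Q' i ys xs = ?p" for Q Q'
  proof -
    \<comment> \<open>The optimum is a real number by \<open>posp\<close>, so equal value rules out
      -\<infinity> for \<open>Q\<close>.\<close>
    have posQ: "?pos (Q i ys xs)" using that posp by (auto simp: F split: if_splits)
    then have "?L (Q i ys xs) = ?L ?p" using that posp kT by (simp add: F)
    then have AE: "AE \<omega> in N. pmf (Q i ys xs) (X i \<omega>) = pmf ?p (X i \<omega>)"
      using N.conditional_Gibbs_eq[OF XN, of "\<lambda>_. ()" "\<lambda>_. Q i ys xs"] posQ by (simp add: lik)
    show ?thesis
    proof (rule pmf_eqI_on_set_pmf)
      show "finite (set_pmf ?p)"
        using finite_subset[OF set_cond_dist_subset[OF i pos] finite_A[OF i]] .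
      fix x assume "x \<in> set_pmf ?p"
      \<comment> \<open>The almost sure equality decides only values of positive probability under
        \<open>N\<close>; the support of \<open>?p\<close> consists of such values.\<close>
      then have "N.prob {\<omega> \<in> space N. X i \<omega> = x} \<noteq> 0"
        using lik[of x "()"] N.prob_space by (auto simp: N.cond_lik_eq set_pmf_iff)
      show "pmf (Q i ys xs) x = pmf ?p x"
      proof (rule ccontr)
        assume neq: "pmf (Q i ys xs) x \<noteq> pmf ?p x"
        have "AE \<omega> in N. \<not> X i \<omega> = x"
          using AE by eventually_elim (use neq in auto)
        then have "N.prob {\<omega> \<in> space N. X i \<omega> = x} = 0"
          using simple_event[OF XN, of "\<lambda>y. y = x"] by (subst N.prob_eq_0) auto
        then show False using \<open>N.prob {\<omega> \<in> space N. X i \<omega> = x} \<noteq> 0\<close> by simp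
      qed
    qed
  qed
  have opt_p: "opt i ys xs = ?p" by (rule opt_eq_cond_dist[OF pos])
  show ?thesis
    unfolding is_arg_max_linorder
  proof
    assume max: "Q \<in> causal_strategies n A \<and> (\<forall>Q'. Q' \<in> causal_strategies n A \<longrightarrow> ?F Q' \<le> ?F Q)"
    \<comment> \<open>\<open>opt\<close> is an admissible strategy that attains the bound at this
      context, so any maximizer has the same value.\<close>
    then have "?F Q = ?F opt" using le[of opt Q] opt_p opt_causal by (intro antisym) blast+
    then show "Q \<in> causal_strategies n A \<and> Q i ys xs = ?p" using max eq[of Q opt] opt_p by blast
  next
    assume "Q \<in> causal_strategies n A \<and> Q i ys xs = ?p"
    then show "Q \<in> causal_strategies n A \<and> (\<forall>Q'. Q' \<in> causal_strategies n A \<longrightarrow> ?F Q' \<le> ?F Q)"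
      using le[of Q] by blast
  qed
qed

end

section \<open>Controllers without measurements\<close>

lemma hist_const: "hist (\<lambda>_ _. c) i \<omega> = replicate i c"
  by (simp add: hist_def map_replicate_const)

text \<open>A constant measurement history is always \<open>replicate i c\<close>; freezing the
  measurement argument of \<open>Q\<close> there gives a blind strategy with the same work at every
  sample point.\<close>

lemma constant_measurement_work_attained_blindly:
  fixes X :: "nat \<Rightarrow> 'w \<Rightarrow> 'a" and Y :: "nat \<Rightarrow> 'w \<Rightarrow> 'b" and c :: 'b
  assumes "Q \<in> causal_strategies n A"
  shows "expected_total_work M kT oi X (\<lambda>_ _. c) n Q \<in>
    expected_total_work M kT oi X Y n ` blind_strategies n A"
proof
  let ?Q = "\<lambda>i (ys :: 'b list) xs. Q i (replicate i c) xs"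
  show "?Q \<in> blind_strategies n A"
    using assms by (auto simp: blind_strategies_def causal_strategies_def)
  show "expected_total_work M kT oi X (\<lambda>_ _. c) n Q = expected_total_work M kT oi X Y n ?Q"
    by (simp add: expected_total_work_def work_def hist_const)
qed

lemma blind_work_measurement_irrelevant:
  assumes "Q \<in> blind_strategies n A"
  shows "expected_total_work M kT oi X Y n Q = expected_total_work M kT oi X Y' n Q"
proof -
  have "Q i ys xs = Q i ys' xs" if "i \<in> {1..n}" for i ys ys' xs
    using assms that unfolding blind_strategies_def by blast
  then have "work kT oi X Y Q i \<omega> = work kT oi X Y' Q i \<omega>" if "i \<in> {1..n}" for i \<omega>
    using that unfolding work_def by metis
  then show ?thesis by (simp add: expected_total_work_def)
qed

text \<open>A blind strategy is causal and earns the same under any measurements; freezing turns a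
  causal strategy for constant measurements into a blind one. So the blind problem inherits the
  causal solution.\<close>

lemma max_work_blind_eq:
  fixes X :: "nat \<Rightarrow> 'w \<Rightarrow> 'a" and Y :: "nat \<Rightarrow> 'w \<Rightarrow> 'b" and c :: 'b
  shows "max_work_blind M kT oi A X Y n = max_work_causal M kT oi A X (\<lambda>_ _. c) n"
  unfolding max_work_blind_def max_work_causal_def
proof (rule antisym)
  show "(SUP Q\<in>blind_strategies n A. expected_total_work M kT oi X Y n Q) \<le>
      (SUP Q\<in>causal_strategies n A. expected_total_work M kT oi X (\<lambda>_ _. c) n Q)"
  proof (rule SUP_mono)
    fix Q :: "nat \<Rightarrow> 'b list \<Rightarrow> 'a list \<Rightarrow> 'a pmf" assume Q: "Q \<in> blind_strategies n A"
    then have "Q \<in> causal_strategies n A" by (simp add: blind_strategies_def)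
    with blind_work_measurement_irrelevant[OF Q]
    show "\<exists>Q'\<in>causal_strategies n A. expected_total_work M kT oi X Y n Q \<le>
        expected_total_work M kT oi X (\<lambda>_ _. c) n Q'"
      by (intro bexI[of _ Q] eq_refl)
  qed
  show "(SUP Q\<in>causal_strategies n A. expected_total_work M kT oi X (\<lambda>_ _. c) n Q) \<le>
      (SUP Q\<in>blind_strategies n A. expected_total_work M kT oi X Y n Q)"
    by (intro SUP_least Sup_upper constant_measurement_work_attained_blindly)
qed

section \<open>The gain as directed information\<close>

theorem mainTheorem3:
  fixes M :: "'w measure"
    and n :: nat
    and X :: "nat \<Rightarrow> 'w \<Rightarrow> 'a" and A :: "nat \<Rightarrow> 'a set"
    and Y :: "nat \<Rightarrow> 'w \<Rightarrow> 'b" and B :: "nat \<Rightarrow> 'b set"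
    and kB T :: real
    and oi :: "nat \<Rightarrow> 'a list \<Rightarrow> real"
  assumes "prob_space M"
    and "\<And>i. i \<in> {1..n} \<Longrightarrow> finite (A i)"
    and "\<And>i. i \<in> {1..n} \<Longrightarrow> finite (B i)"
    and "\<And>i. i \<in> {1..n} \<Longrightarrow> X i \<in> measurable M (count_space (A i))"
    and "\<And>i. i \<in> {1..n} \<Longrightarrow> Y i \<in> measurable M (count_space (B i))"
    and "kB * T > 0"
    and "\<And>i xs. i \<in> {1..n} \<Longrightarrow> xs \<in> listset (map A [1..<Suc i]) \<Longrightarrow> oi i xs > 0"
  shows
    "(\<forall>i\<in>{1..n}. \<forall>ys xs. measure M (context_event M X Y i ys xs) > 0 \<longrightarrow>
        (\<forall>Q. is_arg_max (cond_expected_work M (kB * T) oi X Y i ys xs)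
                 (\<lambda>Q'. Q' \<in> causal_strategies n A) Q \<longleftrightarrow>
               Q \<in> causal_strategies n A \<and> Q i ys xs = cond_dist M X Y i ys xs))
     \<and>
     ((\<exists>Q \<in> causal_strategies n A.
         (\<forall>i\<in>{1..n}. \<forall>ys xs. measure M (context_event M X Y i ys xs) > 0 \<longrightarrow>
            Q i ys xs = cond_dist M X Y i ys xs) \<and>
         expected_total_work M (kB * T) oi X Y n Q = max_work_causal M (kB * T) oi A X Y n)
      \<and>
      max_work_causal M (kB * T) oi A X Y n =
        ereal (- (kB * T) * (\<Sum>i=1..n. causal_cond_entropy M X Y i
                                + prob_space.expectation M (\<lambda>\<omega>. ln (oi i (hist X i \<omega>))))))
     \<and>
     ((\<exists>Q \<in> blind_strategies n A.
         expected_total_work M (kB * T) oi X Y n Q = max_work_blind M (kB * T) oi A X Y n)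
      \<and>
      max_work_causal M (kB * T) oi A X Y n - max_work_blind M (kB * T) oi A X Y n =
        ereal (kB * T * directed_information M Y X n))"
proof -
  interpret W: work_extraction M n X A Y B "kB * T" oi
    by (intro work_extraction.intro work_extraction_axioms.intro assms)
  \<comment> \<open>With singleton alphabets the constant process \<open>C\<close> satisfies the
    locale, and its causal optimum is the blind one; any fixed value would serve as well as
    \<open>undefined\<close>.\<close>
  define C :: "nat \<Rightarrow> 'w \<Rightarrow> 'b" where "C = (\<lambda>_ _. undefined)"
  interpret V: work_extraction M n X A C "\<lambda>_. {undefined}" "kB * T" oi
    by (intro work_extraction.intro work_extraction_axioms.intro assms) (simp_all add: C_def)
  have blind_eq: "max_work_blind M (kB * T) oi A X Y n = ereal V.optimal_value"
    using max_work_blind_eq[of M "kB * T" oi A X Y n "undefined :: 'b"] V.max_work_causal_eq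
    by (simp add: C_def)
  have blind_attained: "\<exists>Q\<in>blind_strategies n A.
      expected_total_work M (kB * T) oi X Y n Q = max_work_blind M (kB * T) oi A X Y n"
    using constant_measurement_work_attained_blindly[OF V.opt_causal, of M "kB * T" oi X undefined Y] V.expected_total_work_opt
    by (auto simp: blind_eq C_def)
  have C_hist: "hist C i \<omega> = hist C i \<omega>'" for i \<omega> \<omega>'
    by (simp add: hist_def C_def)
  have "W.optimal_value - V.optimal_value = kB * T * directed_information M Y X n"
  proof -
    have "W.expectation (\<lambda>\<omega>. ln (cond_lik M (X i) (W.know i) (X i \<omega>) (W.know i \<omega>))) -
        W.expectation (\<lambda>\<omega>. ln (cond_lik M (X i) (V.know i) (X i \<omega>) (V.know i \<omega>))) =
        information_space.conditional_mutual_information_Pow M (exp 1)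
          (X i) (hist Y i) (hist X (i - 1))" if i: "i \<in> {1..n}" for i
    proof -
      \<comment> \<open>The history of \<open>C\<close> is the same at every point, so conditioning
        on it adds nothing to conditioning on the past states.\<close>
      have "cond_lik M (X i) (V.know i) (X i \<omega>) (V.know i \<omega>) =
          cond_lik M (X i) (hist X (i - 1)) (X i \<omega>) (hist X (i - 1) \<omega>)" for \<omega>
        using C_hist by (simp add: cond_lik_def V.know_def)
      moreover have "simple_function M (hist X (i - 1))" "simple_function M (hist Y i)"
        using i by (auto intro!: W.simple_hist_X W.simple_hist_Y)
      ultimately show ?thesis
        using W.simple_X[OF i]
        by (simp add: W.conditional_mutual_information_eq_expectation W.know_def[abs_def])
    qed
    then have "directed_information M Y X n = (\<Sum>i=1..n.
        W.expectation (\<lambda>\<omega>. ln (cond_lik M (X i) (W.know i) (X i \<omega>) (W.know i \<omega>))) -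
        W.expectation (\<lambda>\<omega>. ln (cond_lik M (X i) (V.know i) (X i \<omega>) (V.know i \<omega>))))"
      by (simp add: directed_information_def)
    \<comment> \<open>The terms in \<open>oi\<close> are common to both values and cancel.\<close>
    then show ?thesis
      by (simp add: W.optimal_value_def V.optimal_value_def sum_subtractf right_diff_distrib)
  qed
  then have gain: "max_work_causal M (kB * T) oi A X Y n - max_work_blind M (kB * T) oi A X Y n =
      ereal (kB * T * directed_information M Y X n)"
    by (simp add: W.max_work_causal_eq blind_eq)
  \<comment> \<open>\<open>W.opt\<close> agrees with \<open>cond_dist\<close> in every context of
    positive probability, so this one strategy is optimal in each of them and in total.\<close>
  have "expected_total_work M (kB * T) oi X Y n W.opt = max_work_causal M (kB * T) oi A X Y n"
    by (simp add: W.expected_total_work_opt W.max_work_causal_eq)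
  then have causal_attained: "\<exists>Q \<in> causal_strategies n A.
      (\<forall>i\<in>{1..n}. \<forall>ys xs. measure M (context_event M X Y i ys xs) > 0 \<longrightarrow>
         Q i ys xs = cond_dist M X Y i ys xs) \<and>
      expected_total_work M (kB * T) oi X Y n Q = max_work_causal M (kB * T) oi A X Y n"
    using W.opt_causal W.opt_eq_cond_dist by blast
  show ?thesis
    using W.cond_expected_work_maximizer causal_attained blind_attained gain
      W.max_work_causal_eq[unfolded W.optimal_value_entropy]
    by (intro conjI) blast+
qed

end
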